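(* Let $\frac12<H<1$, $0<\alpha<\frac12$ and $0<1-\alpha<\beta<H$, and let $g=(g_1,\dots,g_m)$ be $\beta$-Hölder continuous on $[0,T]$. Let $b(\varepsilon,t,\cdot):\mathbb{R}^n\to\mathbb{R}^n$ and $\sigma_j(\varepsilon,t,\cdot):\mathbb{R}^n\to\mathbb{R}^n$, $j=1,\dots,m$, be continuously differentiable with uniformly bounded derivatives, and let $\sigma_j(\varepsilon,\cdot,x):[0,T]\to\mathbb{R}^n$, $j=1,\dots,m$, be uniformly Hölder continuous with exponent $\gamma>\alpha$; that is, there is a constant $M\in(0,\infty)$, independent of $\varepsilon,t,x$, such that for all $i,j$ and all $s,t\in[0,T]$, $x\in\mathbb{R}^n$, $$\Big|\frac{\partial}{\partial x_i}b(\varepsilon,t,x)\Big|\le M,\quad\Big|\frac{\partial}{\partial x_i}\sigma_j(\varepsilon,t,x)\Big|\le M,\quad|\sigma_j(\varepsilon,t,x)-\sigma_j(\varepsilon,s,x)|\le M|t-s|^\gamma.$$ Assume also the uniform linear growth condition $|b(\varepsilon,t,x)|\le M(1+|x|)$ and $|\sigma_j(\varepsilon,t,x)|\le M(1+|x|)$. Let $x^\varepsilon$ be the solution of $$x^\varepsilon(t)=x_0+\int_0^tb(\varepsilon,s,x^\varepsilon(s))\,ds+\sum_{j=1}^m\int_0^t\sigma_j(\varepsilon,s,x^\varepsilon(s))\,dg_j(s),\quad 0\le t\le T.$$ Then there are constants $C$ and $c$, independent of $\varepsilon$, $M$ and $g$, such that for all $T$, $$\sup_{0\le t\le T}|x^\varepsilon(t)|\le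 Ce^{c\|g\|_{0,T,\beta}^{1/\beta}}(|x_0|+1)\qquad\text{and}\qquad\|x^\varepsilon\|_{0,T,\beta}\le Ce^{c\|g\|_{0,T,\beta}^{1/\beta}}(|x_0|+1).$$
   Context: $\|x\|_{a,b,\beta}=\sup_{a\le\theta<r\le b}\frac{|x_r-x_\theta|}{|r-\theta|^\beta}$ is the $\beta$-Hölder seminorm on $[a,b]$. $\varepsilon$ is a real parameter and $x_0\in\mathbb{R}^n$ is the initial value. The integrals against $g_j$ are Riemann–Stieltjes integrals, and a solution is understood as a $\beta$-Hölder continuous function $x^\varepsilon:[0,T]\to\mathbb{R}^n$ for which the integral equation makes sense and holds.
   Formalization: C and c may depend on T and on the coefficients b, σ (hence on their size M); they are independent of ε, g, x_0 and of which valid M is chosen. Full independence of T and M is false: b=Mx, σ=0, g=0, x_0=1 gives x(t)=e^{Mt}. *)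

theory Defs
  imports "HOL-Analysis.Analysis"
begin

definition holder_on :: "real \<Rightarrow> real \<Rightarrow> real \<Rightarrow> (real \<Rightarrow> 'a::real_normed_vector) \<Rightarrow> bool" where
  "holder_on a b \<beta> f \<longleftrightarrow>
     (\<exists>K. \<forall>\<theta>\<in>{a..b}. \<forall>r\<in>{a..b}. norm (f r - f \<theta>) \<le> K * \<bar>r - \<theta>\<bar> powr \<beta>)"

text \<open>The supremum is taken in the reals, so it is meaningful only for \<open>a < b\<close> and
  a function that is Hoelder continuous on \<open>[a, b]\<close> with exponent \<open>\<beta>\<close>.\<close>

definition holder_seminorm :: "real \<Rightarrow> real \<Rightarrow> real \<Rightarrow> (real \<Rightarrow> 'a::real_normed_vector) \<Rightarrow> real" where
  "holder_seminorm a b \<beta> f =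
     (SUP (\<theta>, r) \<in> {(\<theta>, r). a \<le> \<theta> \<and> \<theta> < r \<and> r \<le> b}. norm (f r - f \<theta>) / \<bar>r - \<theta>\<bar> powr \<beta>)"

definition partial_deriv :: "'n \<Rightarrow> (real^'n \<Rightarrow> 'a::real_normed_vector) \<Rightarrow> real^'n \<Rightarrow> 'a" where
  "partial_deriv i f x = vector_derivative (\<lambda>h. f (x + h *\<^sub>R axis i 1)) (at 0)"

definition continuously_differentiable ::
    "('a::real_normed_vector \<Rightarrow> 'b::real_normed_vector) \<Rightarrow> bool" where
  "continuously_differentiable f \<longleftrightarrow>
     (\<exists>f' :: 'a \<Rightarrow> 'a \<Rightarrow>\<^sub>L 'b.
        (\<forall>x. (f has_derivative blinfun_apply (f' x)) (at x)) \<and> continuous_on UNIV f')"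

text \<open>Riemann--Stieltjes integral of \<open>f\<close> against \<open>g\<close> over \<open>[a, b]\<close> in the classical sense, as
  the limit of the tagged sums when the mesh tends to zero (not in the gauge sense).
  Degenerate intervals of a tagged division contribute nothing to the sums.\<close>

definition has_rs_integral ::
    "(real \<Rightarrow> 'a::real_normed_vector) \<Rightarrow> (real \<Rightarrow> real) \<Rightarrow> real \<Rightarrow> real \<Rightarrow> 'a \<Rightarrow> bool" where
  "has_rs_integral f g a b I \<longleftrightarrow>
     (\<forall>e>0. \<exists>\<delta>>0. \<forall>p. p tagged_division_of {a..b} \<and> (\<forall>(\<xi>, k)\<in>p. Sup k - Inf k < \<delta>) \<longrightarrow>
        norm ((\<Sum>(\<xi>, k)\<in>p. (g (Sup k) - g (Inf k)) *\<^sub>R f \<xi>) - I) < e)"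

definition rs_integrable ::
    "(real \<Rightarrow> 'a::real_normed_vector) \<Rightarrow> (real \<Rightarrow> real) \<Rightarrow> real \<Rightarrow> real \<Rightarrow> bool" where
  "rs_integrable f g a b \<longleftrightarrow> (\<exists>I. has_rs_integral f g a b I)"

definition rs_integral ::
    "(real \<Rightarrow> 'a::real_normed_vector) \<Rightarrow> (real \<Rightarrow> real) \<Rightarrow> real \<Rightarrow> real \<Rightarrow> 'a" where
  "rs_integral f g a b = (THE I. has_rs_integral f g a b I)"

text \<open>Here \<open>b t x\<close> and \<open>\<sigma> j t x\<close> are the coefficients for one fixed value of the parameter.\<close>

definition solves_equation ::
    "real \<Rightarrow> real \<Rightarrow> (real \<Rightarrow> real^'n \<Rightarrow> real^'n) \<Rightarrow> ('m \<Rightarrow> real \<Rightarrow> real^'n \<Rightarrow> real^'n) \<Rightarrow>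
     (real \<Rightarrow> real^'m) \<Rightarrow> real^'n \<Rightarrow> (real \<Rightarrow> real^'n) \<Rightarrow> bool" where
  "solves_equation T \<beta> b \<sigma> g x\<^sub>0 x \<longleftrightarrow>
     holder_on 0 T \<beta> x \<and>
     (\<forall>t\<in>{0..T}.
        (\<lambda>s. b s (x s)) integrable_on {0..t} \<and>
        (\<forall>j. rs_integrable (\<lambda>s. \<sigma> j s (x s)) (\<lambda>s. g s $ j) 0 t) \<and>
        x t = x\<^sub>0 + integral {0..t} (\<lambda>s. b s (x s))
              + (\<Sum>j\<in>UNIV. rs_integral (\<lambda>s. \<sigma> j s (x s)) (\<lambda>s. g s $ j) 0 t))"

text \<open>The coefficients take the parameter \<open>\<epsilon>\<close> as an argument (after the index \<open>j\<close> in the case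
  of \<open>\<sigma>\<close>), and a single \<open>M\<close> serves for all its values.\<close>

definition coefficient_bounds ::
    "real \<Rightarrow> real \<Rightarrow> (real \<Rightarrow> real \<Rightarrow> real^'n \<Rightarrow> real^'n) \<Rightarrow>
     ('m \<Rightarrow> real \<Rightarrow> real \<Rightarrow> real^'n \<Rightarrow> real^'n) \<Rightarrow> real \<Rightarrow> bool" where
  "coefficient_bounds T \<gamma> b \<sigma> M \<longleftrightarrow>
     (\<forall>\<epsilon>. \<forall>t\<in>{0..T}. \<forall>x.
        (\<forall>i. norm (partial_deriv i (b \<epsilon> t) x) \<le> M) \<and>
        (\<forall>i j. norm (partial_deriv i (\<sigma> j \<epsilon> t) x) \<le> M) \<and>
        (\<forall>j. \<forall>s\<in>{0..T}. norm (\<sigma> j \<epsilon> t x - \<sigma> j \<epsilon> s x) \<le> M * \<bar>t - s\<bar> powr \<gamma>) \<and>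
        norm (b \<epsilon> t x) \<le> M * (1 + norm x) \<and>
        (\<forall>j. norm (\<sigma> j \<epsilon> t x) \<le> M * (1 + norm x)))"

end

theory Submission
  imports Defs
begin

text \<open>
  Write \<open>G\<close> for the \<open>\<beta>\<close>-Hoelder seminorm of the driving path \<open>g\<close>. The bound is a Gronwall
  argument whose step length is adapted to \<open>G\<close>.

  The Young--Loeve inequality (\<open>young_loeve_estimate\<close>) controls the integral of a
  \<open>\<rho>\<close>-Hoelder function against a \<open>\<beta>\<close>-Hoelder one, \<open>\<rho> + \<beta> > 1\<close>, up to its first-order
  term \<open>f(s) (g(t) - g(s))\<close>. Here \<open>\<rho> = min \<gamma> \<beta>\<close>, and the condition on the
  exponents follows from \<open>\<gamma> > \<alpha>\<close> and \<open>\<beta> > 1 - \<alpha> > 1/2\<close>. Existence of the integrals is part of the notion of solution, so only the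
  convergence of dyadic left sums has to be made quantitative.

  Applied to \<open>f(r) = \<sigma>(r, x(r))\<close>, together with linear growth for the drift and the first-order
  term, it shows that whenever \<open>x\<close> has Hoelder constant \<open>L\<close> on \<open>[s, t]\<close>,
  \<open>|x_t - x_s| \<le> P (1 + |x_s| + L (t - s)^\<beta>) (t - s)^\<beta>\<close> with \<open>P = A (1 + G)\<close>,
  where \<open>A\<close> depends only on the coefficients, the exponents and \<open>T\<close>
  (\<open>solution_controlled_increments\<close>). On intervals with
  \<open>P (t - s)^\<beta> \<le> 1/4\<close> the term with \<open>L\<close> is absorbed into the left-hand side, the Hoelder
  constant there is at most \<open>2 P (1 + |x_s|)\<close>, and \<open>1 + |x|\<close> at most doubles. Such an interval may
  have length \<open>(4P)^(-1/\<beta>)\<close>, so \<open>[0, T]\<close> is covered by about \<open>T (4P)^(1/\<beta>)\<close> of them, and the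
  total growth factor is exponential in \<open>P^(1/\<beta>)\<close>, hence in \<open>G^(1/\<beta>)\<close>
  (\<open>controlled_increments_growth\<close>). The seminorm of \<open>x\<close> on all of \<open>[0, T]\<close> costs one further
  factor \<open>P\<close>, which the exponential absorbs too (\<open>absorb_noise_into_exponential\<close>).
\<close>

section \<open>Left Riemann--Stieltjes sums\<close>

text \<open>The definition of the integral speaks of all fine tagged divisions; its value can be computed
  along one explicit family of them, the equidistant divisions with left end points as tags. The case
  \<open>a = b\<close> is included because the integral up to time \<open>0\<close> occurs in the equation.\<close>

lemma uniform_tagged_division:
  fixes a b :: real
  assumes "a \<le> b" "N > 0"
  defines "q \<equiv> \<lambda>i::nat. a + real i * ((b - a) / real N)"
  shows "(\<lambda>i. (q i, {q i..q (Suc i)})) ` {..<N} tagged_division_of {a..b}"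
proof -
  have step: "q i \<le> q j" if "i \<le> j" for i j
    unfolding q_def using that assms by (intro add_left_mono mult_right_mono) auto
  have q0: "q 0 = a" and qN: "q N = b"
    using assms by (auto simp: q_def)
  have cover: "(\<Union>i<n. {q i..q (Suc i)}) = {q 0..q n}" if "n > 0" for n
    using that
  proof (induction n)
    case (Suc n)
    show ?case
    proof (cases "n = 0")
      case False
      then show ?thesis
        using Suc step[of 0 n] step[of n "Suc n"]
        by (auto simp: lessThan_Suc ivl_disj_un)
    qed auto
  qed simp
  have disj: "interior {q i..q (Suc i)} \<inter> interior {q j..q (Suc j)} = {}" if "i < j" for i j
    using step[of "Suc i" j] that by auto
  show ?thesis
  proof (rule tagged_division_ofI)
    fix \<xi> k assume "(\<xi>, k) \<in> (\<lambda>i. (q i, {q i..q (Suc i)})) ` {..<N}"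
    then obtain i where i: "i < N" "\<xi> = q i" "k = {q i..q (Suc i)}" by auto
    show "\<xi> \<in> k" using i step[of i "Suc i"] by auto
    show "k \<subseteq> {a..b}"
      using i step[of 0 i] step[of "Suc i" N] q0 qN by auto
    show "\<exists>u v. k = cbox u v" using i by (auto simp: cbox_interval)
  next
    fix \<xi> k \<xi>' k'
    assume "(\<xi>, k) \<in> (\<lambda>i. (q i, {q i..q (Suc i)})) ` {..<N}"
      and "(\<xi>', k') \<in> (\<lambda>i. (q i, {q i..q (Suc i)})) ` {..<N}"
      and ne: "(\<xi>, k) \<noteq> (\<xi>', k')"
    then obtain i j where "k = {q i..q (Suc i)}" "k' = {q j..q (Suc j)}" "i \<noteq> j" by auto
    then show "interior k \<inter> interior k' = {}"
      using disj[of i j] disj[of j i] by (cases "i < j") auto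
  next
    have "\<Union> {k. \<exists>x. (x, k) \<in> (\<lambda>i. (q i, {q i..q (Suc i)})) ` {..<N}}
      = (\<Union>i<N. {q i..q (Suc i)})" by auto
    also have "\<dots> = {a..b}" using cover[OF assms(2)] q0 qN by simp
    finally show "\<Union> {k. \<exists>x. (x, k) \<in> (\<lambda>i. (q i, {q i..q (Suc i)})) ` {..<N}} = {a..b}" .
  qed simp
qed

definition left_sum :: "(real \<Rightarrow> 'a::real_normed_vector) \<Rightarrow> (real \<Rightarrow> real) \<Rightarrow> real \<Rightarrow> real \<Rightarrow> nat \<Rightarrow> 'a" where
  "left_sum f g a b N = (\<Sum>i<N. (g (a + real (Suc i) * ((b - a) / real N)) - g (a + real i * ((b - a) / real N)))
      *\<^sub>R f (a + real i * ((b - a) / real N)))"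

lemma fine_uniform_division:
  fixes f :: "real \<Rightarrow> 'a::real_normed_vector"
  assumes "a \<le> b" "N > 0" "(b - a) / real N < \<delta>"
  obtains p where "p tagged_division_of {a..b}" "\<forall>(\<xi>, k)\<in>p. Sup k - Inf k < \<delta>"
    "(\<Sum>(\<xi>, k)\<in>p. (g (Sup k) - g (Inf k)) *\<^sub>R f \<xi>) = left_sum f g a b N"
proof -
  define q where "q \<equiv> \<lambda>i::nat. a + real i * ((b - a) / real N)"
  define h where "h \<equiv> \<lambda>i. (q i, {q i..q (Suc i)})"
  have le: "q i \<le> q (Suc i)" for i
    unfolding q_def using assms by (intro add_left_mono mult_right_mono) auto
  have SI: "Sup {q i..q (Suc i)} = q (Suc i)" "Inf {q i..q (Suc i)} = q i" for i
    using le[of i] by auto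
  show thesis
  proof (rule that)
    show "h ` {..<N} tagged_division_of {a..b}"
      unfolding h_def q_def by (rule uniform_tagged_division) fact+
    have "q (Suc i) - q i = (b - a) / real N" for i
      by (simp add: q_def algebra_simps add_divide_distrib diff_divide_distrib)
    then show "\<forall>(\<xi>, k)\<in>h ` {..<N}. Sup k - Inf k < \<delta>"
      using assms(3) by (auto simp: h_def SI)
    \<comment> \<open>The same tagged interval can arise from two indices only if it is degenerate (\<open>a = b\<close>),
      and then its term is zero.\<close>
    have "(\<Sum>(\<xi>, k)\<in>h ` {..<N}. (g (Sup k) - g (Inf k)) *\<^sub>R f \<xi>)
        = (\<Sum>i<N. (case h i of (\<xi>, k) \<Rightarrow> (g (Sup k) - g (Inf k)) *\<^sub>R f \<xi>))"
    proof (subst sum.reindex_nontrivial)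
      fix i j assume "i \<noteq> j" "h i = h j"
      then have "q (min i j) = q (max i j)" by (auto simp: h_def min_def max_def)
      then have "real (min i j) * ((b - a) / real N) = real (max i j) * ((b - a) / real N)"
        by (simp add: q_def)
      moreover have "real (min i j) \<noteq> real (max i j)" using \<open>i \<noteq> j\<close> by auto
      ultimately have "(b - a) / real N = 0" using mult_right_cancel by blast
      then have "q (Suc i) = q i" by (simp only: q_def mult_zero_right)
      then show "(case h i of (\<xi>, k) \<Rightarrow> (g (Sup k) - g (Inf k)) *\<^sub>R f \<xi>) = 0"
        by (simp add: h_def)
    qed (simp_all add: o_def)
    also have "\<dots> = left_sum f g a b N"
      by (simp only: h_def prod.case SI) (simp add: left_sum_def q_def)
    finally show "(\<Sum>(\<xi>, k)\<in>h ` {..<N}. (g (Sup k) - g (Inf k)) *\<^sub>R f \<xi>) = left_sum f g a b N" .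
  qed
qed

lemma eventually_mesh_less:
  fixes d \<delta> :: real
  assumes "\<delta> > 0"
  shows "\<forall>\<^sub>F N in sequentially. N > 0 \<and> d / real N < \<delta>"
proof -
  have "((\<lambda>N. d / real N) \<longlongrightarrow> 0) sequentially" by (rule lim_const_over_n)
  then have "\<forall>\<^sub>F N in sequentially. d / real N < \<delta>"
    using assms by (rule order_tendstoD)
  with eventually_gt_at_top[of 0] show ?thesis by (rule eventually_conj)
qed

lemma has_rs_integral_left_sums:
  assumes "has_rs_integral f g a b I" "a \<le> b"
  shows "left_sum f g a b \<longlonglongrightarrow> I"
proof (rule tendstoI)
  fix e :: real assume "e > 0"
  from assms(1)[unfolded has_rs_integral_def, THEN spec, THEN mp, OF this]
  obtain \<delta> where "\<delta> > 0" and \<delta>: "\<forall>p. p tagged_division_of {a..b} \<and>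
      (\<forall>(\<xi>, k)\<in>p. Sup k - Inf k < \<delta>) \<longrightarrow>
      norm ((\<Sum>(\<xi>, k)\<in>p. (g (Sup k) - g (Inf k)) *\<^sub>R f \<xi>) - I) < e"
    by (elim exE conjE)
  show "\<forall>\<^sub>F N in sequentially. dist (left_sum f g a b N) I < e"
    using eventually_mesh_less[OF \<open>\<delta> > 0\<close>, of "b - a"]
  proof eventually_elim
    case (elim N)
    then have N: "N > 0" "(b - a) / real N < \<delta>" by simp_all
    obtain p where p: "p tagged_division_of {a..b}" "\<forall>(\<xi>, k)\<in>p. Sup k - Inf k < \<delta>"
      and S: "(\<Sum>(\<xi>, k)\<in>p. (g (Sup k) - g (Inf k)) *\<^sub>R f \<xi>) = left_sum f g a b N"
      by (rule fine_uniform_division[OF assms(2) N])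
    show ?case using \<delta>[THEN spec, THEN mp, OF conjI[OF p]] by (simp add: S dist_norm)
  qed
qed

lemma rs_integral_eqI:
  assumes "has_rs_integral f g a b I" "a \<le> b"
  shows "rs_integral f g a b = I"
  unfolding rs_integral_def
proof (rule the_equality)
  show "J = I" if "has_rs_integral f g a b J" for J
    using has_rs_integral_left_sums[OF that assms(2)] has_rs_integral_left_sums[OF assms]
    by (rule LIMSEQ_unique)
qed fact

lemma rs_integral_degenerate:
  assumes "rs_integrable f g a a"
  shows "rs_integral f g a a = 0"
proof -
  from assms[unfolded rs_integrable_def] obtain I where I: "has_rs_integral f g a a I"
    by (elim exE)
  have "left_sum f g a a = (\<lambda>_. 0)" by (simp add: left_sum_def fun_eq_iff)
  with has_rs_integral_left_sums[OF I order_refl] have "(\<lambda>_::nat. 0) \<longlonglongrightarrow> I" by simp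
  then have "I = 0" using LIMSEQ_unique tendsto_const by blast
  then show ?thesis using rs_integral_eqI[OF I order_refl] by simp
qed

text \<open>Additivity over adjacent intervals in subtracted form: integrability on \<open>[s, c]\<close> is inherited,
  since a fine division of \<open>[s, c]\<close> is completed to one of \<open>[a, c]\<close> by a single fine equidistant
  division of \<open>[a, s]\<close> whose sum is already close to \<open>J\<close>.\<close>

lemma has_rs_integral_diff:
  assumes I: "has_rs_integral f g a c I" and J: "has_rs_integral f g a s J"
    and "a \<le> s" "s \<le> c"
  shows "has_rs_integral f g s c (I - J)"
  unfolding has_rs_integral_def
proof (intro allI impI)
  fix e :: real assume "e > 0"
  define S where "S \<equiv> \<lambda>p. \<Sum>(\<xi>, k)\<in>p. (g (Sup k) - g (Inf k)) *\<^sub>R f \<xi>"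
  have "e / 2 > 0" using \<open>e > 0\<close> by simp
  from I[unfolded has_rs_integral_def, THEN spec, THEN mp, OF this]
  obtain \<delta> where "\<delta> > 0" and \<delta>: "\<forall>p. p tagged_division_of {a..c} \<and>
      (\<forall>(\<xi>, k)\<in>p. Sup k - Inf k < \<delta>) \<longrightarrow> norm (S p - I) < e / 2"
    unfolding S_def by (elim exE conjE)
  have ev: "\<forall>\<^sub>F N in sequentially. dist (left_sum f g a s N) J < e / 2"
    using has_rs_integral_left_sums[OF J \<open>a \<le> s\<close>] \<open>e > 0\<close> by (intro tendstoD) auto
  have "\<exists>N. (N > 0 \<and> (s - a) / real N < \<delta>) \<and> dist (left_sum f g a s N) J < e / 2"
    by (rule eventually_happens'[OF sequentially_bot eventually_conj[OF eventually_mesh_less[OF \<open>\<delta> > 0\<close>] ev]])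
  then obtain N where N: "N > 0" "(s - a) / real N < \<delta>" "dist (left_sum f g a s N) J < e / 2"
    by (elim exE conjE)
  obtain p' where p': "p' tagged_division_of {a..s}" "\<forall>(\<xi>, k)\<in>p'. Sup k - Inf k < \<delta>"
      "S p' = left_sum f g a s N"
    unfolding S_def by (rule fine_uniform_division[OF \<open>a \<le> s\<close> N(1,2), where f = f and g = g])
  show "\<exists>\<delta>>0. \<forall>p. p tagged_division_of {s..c} \<and> (\<forall>(\<xi>, k)\<in>p. Sup k - Inf k < \<delta>) \<longrightarrow>
      norm ((\<Sum>(\<xi>, k)\<in>p. (g (Sup k) - g (Inf k)) *\<^sub>R f \<xi>) - (I - J)) < e"
  proof (rule exI[of _ \<delta>], rule conjI[OF \<open>\<delta> > 0\<close>], intro allI impI)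
    fix p assume p: "p tagged_division_of {s..c} \<and> (\<forall>(\<xi>, k)\<in>p. Sup k - Inf k < \<delta>)"
    have "p' \<union> p tagged_division_of {a..s} \<union> {s..c}"
      using p p'(1) by (intro tagged_division_Un) auto
    then have "p' \<union> p tagged_division_of {a..c}"
      using \<open>a \<le> s\<close> \<open>s \<le> c\<close> by (simp add: ivl_disj_un)
    then have *: "norm (S (p' \<union> p) - I) < e / 2"
      by (rule \<delta>[THEN spec, THEN mp, OF conjI]) (use p p'(2) in \<open>simp add: ball_Un\<close>)
    \<comment> \<open>A common element of both divisions is the degenerate interval at \<open>s\<close>.\<close>
    have "\<forall>z\<in>p' \<inter> p. (case z of (\<xi>, k) \<Rightarrow> (g (Sup k) - g (Inf k)) *\<^sub>R f \<xi>) = 0"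
    proof (clarsimp simp del: scaleR_eq_0_iff)
      fix \<xi> k assume k: "(\<xi>, k) \<in> p'" "(\<xi>, k) \<in> p"
      have "\<xi> \<in> k" by (rule tagged_division_ofD(2)[OF p'(1) k(1)])
      moreover have "k \<subseteq> {a..s}" by (rule tagged_division_ofD(3)[OF p'(1) k(1)])
      moreover have "k \<subseteq> {s..c}" by (rule tagged_division_ofD(3)[OF conjunct1[OF p] k(2)])
      ultimately have "k = {s}" by fastforce
      then show "(g (Sup k) - g (Inf k)) *\<^sub>R f \<xi> = 0" by simp
    qed
    moreover have "finite p'" "finite p" using p p'(1) by auto
    ultimately have "S (p' \<union> p) = S p' + S p"
      unfolding S_def by (intro sum.union_inter_neutral)
    then have "S p - (I - J) = (S (p' \<union> p) - I) - (S p' - J)" by simp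
    then have "norm (S p - (I - J)) \<le> norm (S (p' \<union> p) - I) + norm (S p' - J)"
      using norm_triangle_ineq4 by metis
    also have "\<dots> < e"
      using * N(3) p'(3) by (simp add: dist_norm)
    finally show "norm ((\<Sum>(\<xi>, k)\<in>p. (g (Sup k) - g (Inf k)) *\<^sub>R f \<xi>) - (I - J)) < e"
      by (simp add: S_def)
  qed
qed

section \<open>The Young--Loeve estimate\<close>

lemma sum_lessThan_double:
  fixes h :: "nat \<Rightarrow> 'a::comm_monoid_add"
  shows "(\<Sum>i<2 * N. h i) = (\<Sum>i<N. h (2 * i) + h (2 * i + 1))"
  by (induction N) (simp_all add: add.assoc)

text \<open>Inserting the midpoint \<open>m\<close> into \<open>[l, r]\<close> changes its term by
  \<open>(g r - g m) (f m - f l)\<close> only. This product of two increments is of order \<open>\<rho> + \<beta> > 1\<close> in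
  the mesh, which is what makes the dyadic left sums a geometrically convergent sequence.\<close>

lemma left_sum_refine:
  fixes f :: "real \<Rightarrow> 'a::real_normed_vector"
  assumes f: "\<And>u r. u \<in> {s..t} \<Longrightarrow> r \<in> {s..t} \<Longrightarrow> norm (f r - f u) \<le> F * \<bar>r - u\<bar> powr \<rho>"
    and g: "\<And>u r. u \<in> {s..t} \<Longrightarrow> r \<in> {s..t} \<Longrightarrow> \<bar>g r - g u\<bar> \<le> G * \<bar>r - u\<bar> powr \<beta>"
    and "s \<le> t" "0 \<le> F" "0 \<le> G" "N > 0"
  shows "norm (left_sum f g s t (2 * N) - left_sum f g s t N)
    \<le> real N * (F * G * ((t - s) / real (2 * N)) powr (\<rho> + \<beta>))"
proof -
  define h where "h = (t - s) / real (2 * N)"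
  define q where "q \<equiv> \<lambda>i::nat. s + real i * h"
  have "h \<ge> 0" using assms by (simp add: h_def)
  have 1: "left_sum f g s t (2 * N) = (\<Sum>i<N. (g (q (2*i+1)) - g (q (2*i))) *\<^sub>R f (q (2*i))
      + (g (q (2*i+2)) - g (q (2*i+1))) *\<^sub>R f (q (2*i+1)))"
    unfolding left_sum_def h_def[symmetric] sum_lessThan_double by (simp add: q_def)
  have 2: "real i * ((t - s) / real N) = real (2 * i) * h" for i
    by (simp add: h_def)
  have 3: "left_sum f g s t N = (\<Sum>i<N. (g (q (2*i+2)) - g (q (2*i))) *\<^sub>R f (q (2*i)))"
    unfolding left_sum_def 2 by (simp add: q_def)
  have inI: "q i \<in> {s..t}" if "i \<le> 2 * N" for i
  proof -
    have "real i * h \<le> real (2 * N) * h" using that \<open>h \<ge> 0\<close> by (intro mult_right_mono) auto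
    also have "\<dots> = t - s" using \<open>N > 0\<close> by (simp add: h_def)
    finally show ?thesis using \<open>h \<ge> 0\<close> by (simp add: q_def)
  qed
  have "norm (left_sum f g s t (2 * N) - left_sum f g s t N)
     = norm (\<Sum>i<N. (g (q (2*i+2)) - g (q (2*i+1))) *\<^sub>R (f (q (2*i+1)) - f (q (2*i))))"
    unfolding 1 3 sum_subtractf[symmetric]
    by (intro arg_cong[where f = norm] sum.cong) (simp_all add: algebra_simps)
  also have "\<dots> \<le> (\<Sum>i<N. F * G * h powr (\<rho> + \<beta>))"
  proof (rule sum_norm_le)
    fix i assume "i \<in> {..<N}"
    then have le: "2*i+2 \<le> 2*N" by auto
    have d: "\<bar>q (2*i+2) - q (2*i+1)\<bar> = h" "\<bar>q (2*i+1) - q (2*i)\<bar> = h"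
      using \<open>h \<ge> 0\<close> by (simp_all add: q_def algebra_simps)
    have "\<bar>g (q (2*i+2)) - g (q (2*i+1))\<bar> * norm (f (q (2*i+1)) - f (q (2*i)))
        \<le> (G * h powr \<beta>) * (F * h powr \<rho>)"
      using f[of "q (2*i)" "q (2*i+1)"] g[of "q (2*i+1)" "q (2*i+2)"] inI le \<open>0 \<le> G\<close>
      unfolding d by (intro mult_mono) auto
    then show "norm ((g (q (2*i+2)) - g (q (2*i+1))) *\<^sub>R (f (q (2*i+1)) - f (q (2*i)))) \<le> F * G * h powr (\<rho> + \<beta>)"
      by (simp add: powr_add mult_ac)
  qed
  also have "\<dots> = real N * (F * G * h powr (\<rho> + \<beta>))" by simp
  finally show ?thesis unfolding h_def .
qed

definition young_loeve_const :: "real \<Rightarrow> real" where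
  "young_loeve_const \<theta> = 1 / (1 - 2 powr (1 - \<theta>))"

lemma young_loeve_const_nonneg:
  assumes "1 < \<theta>"
  shows "0 \<le> young_loeve_const \<theta>"
  using powr_less_mono[of "1 - \<theta>" 0 2] assms by (simp add: young_loeve_const_def)

text \<open>The dyadic left sums start at \<open>(g t - g s) f s\<close>, converge to the integral, and by
  the refinement estimate the \<open>n\<close>-th step is at most \<open>F G (t - s)^\<theta> w^n\<close> with \<open>\<theta> = \<rho> + \<beta>\<close>
  and ratio \<open>w = 2^(1 - \<theta>) < 1\<close>. The geometric series gives the constant.\<close>

lemma young_loeve_estimate:
  fixes f :: "real \<Rightarrow> 'a::real_normed_vector"
  assumes I: "has_rs_integral f g s t I" and "s \<le> t"
    and f: "\<And>u r. u \<in> {s..t} \<Longrightarrow> r \<in> {s..t} \<Longrightarrow> norm (f r - f u) \<le> F * \<bar>r - u\<bar> powr \<rho>"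
    and g: "\<And>u r. u \<in> {s..t} \<Longrightarrow> r \<in> {s..t} \<Longrightarrow> \<bar>g r - g u\<bar> \<le> G * \<bar>r - u\<bar> powr \<beta>"
    and FG: "0 \<le> F" "0 \<le> G" and "\<rho> + \<beta> > 1"
  shows "norm (I - (g t - g s) *\<^sub>R f s)
    \<le> young_loeve_const (\<rho> + \<beta>) * (F * G * (t - s) powr (\<rho> + \<beta>))"
proof -
  define \<theta> where "\<theta> = \<rho> + \<beta>"
  define w where "w = 2 powr (1 - \<theta>)"
  define B where "B = F * G * (t - s) powr \<theta>"
  define D where "D \<equiv> \<lambda>n. left_sum f g s t (2 ^ n)"
  have w: "0 < w" "w < 1"
    using \<open>\<rho> + \<beta> > 1\<close> powr_less_mono[of "1 - \<theta>" 0 2] by (simp_all add: w_def \<theta>_def)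
  have "B \<ge> 0" using FG by (simp add: B_def)
  have step: "norm (D (Suc n) - D n) \<le> B * w ^ n" for n
  proof -
    have "norm (D (Suc n) - D n) \<le> real (2 ^ n) * (F * G * ((t - s) / real (2 * 2 ^ n)) powr \<theta>)"
      unfolding D_def \<theta>_def power_Suc using assms by (intro left_sum_refine) auto
    also have "((t - s) / real (2 * 2 ^ n)) powr \<theta> = (t - s) powr \<theta> / (2 powr real (Suc n)) powr \<theta>"
      using \<open>s \<le> t\<close> by (subst powr_divide) (simp_all add: powr_realpow del: of_nat_Suc)
    also have "real (2 ^ n) = 2 powr real n" by (simp add: powr_realpow)
    also have "2 powr real n * (F * G * ((t - s) powr \<theta> / (2 powr real (Suc n)) powr \<theta>))
        = B * (2 powr real n / (2 powr real (Suc n)) powr \<theta>)"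
      by (simp add: B_def)
    also have "2 powr real n / (2 powr real (Suc n)) powr \<theta> = w powr real n * 2 powr (- \<theta>)"
      unfolding w_def powr_powr powr_diff[symmetric] powr_add[symmetric]
      by (simp add: algebra_simps)
    also have "B * (w powr real n * 2 powr (- \<theta>)) \<le> B * (w powr real n * 1)"
      using \<open>B \<ge> 0\<close> \<open>\<rho> + \<beta> > 1\<close> powr_mono[of "- \<theta>" 0 2]
      by (intro mult_left_mono) (auto simp: \<theta>_def)
    finally show ?thesis using w by (simp add: powr_realpow)
  qed
  have bound: "norm (D n - D 0) \<le> B * (1 / (1 - w))" for n
  proof -
    have "norm (D n - D 0) = norm (\<Sum>i<n. D (Suc i) - D i)"
      by (simp add: sum_lessThan_telescope)
    also have "\<dots> \<le> (\<Sum>i<n. B * w ^ i)" using step by (intro sum_norm_le) auto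
    also have "\<dots> = B * (\<Sum>i<n. w ^ i)" by (simp add: sum_distrib_left)
    also have "(\<Sum>i<n. w ^ i) \<le> (\<Sum>i. w ^ i)"
      using w by (intro sum_le_suminf) (auto intro: summable_geometric)
    also have "(\<Sum>i. w ^ i) = 1 / (1 - w)" using w by (simp add: suminf_geometric)
    finally show ?thesis using \<open>B \<ge> 0\<close> by (simp add: mult_left_mono)
  qed
  have "D \<longlonglongrightarrow> I"
    using LIMSEQ_subseq_LIMSEQ[OF has_rs_integral_left_sums[OF I \<open>s \<le> t\<close>], of "\<lambda>n. 2 ^ n"]
    by (simp add: D_def strict_mono_def o_def)
  then have "(\<lambda>n. norm (D n - D 0)) \<longlonglongrightarrow> norm (I - D 0)"
    by (intro tendsto_intros)
  then have "norm (I - D 0) \<le> B * (1 / (1 - w))"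
    by (rule LIMSEQ_le_const2) (use bound in auto)
  then show ?thesis
    by (simp add: D_def left_sum_def B_def w_def \<theta>_def young_loeve_const_def)
qed

section \<open>Lipschitz bounds and the Hoelder seminorm\<close>

lemma lipschitz_of_partial_deriv_bound:
  fixes F :: "real^'n \<Rightarrow> 'a::real_normed_vector"
  assumes "continuously_differentiable F"
    and M: "\<And>i z. norm (partial_deriv i F z) \<le> M"
  shows "norm (F y - F x) \<le> real CARD('n) * M * norm (y - x)"
proof -
  obtain F' where F': "\<And>z. (F has_derivative blinfun_apply (F' z)) (at z)"
    using assms(1) unfolding continuously_differentiable_def by blast
  have partial: "blinfun_apply (F' z) (axis i 1) = partial_deriv i F z" for i z
  proof -
    have "((\<lambda>h. F (z + h *\<^sub>R axis i 1)) has_derivative (\<lambda>h. blinfun_apply (F' z) (h *\<^sub>R axis i 1))) (at 0)"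
    proof (rule has_derivative_compose[where g = F, where f = "\<lambda>h. z + h *\<^sub>R axis i 1"])
      show "((\<lambda>h. z + h *\<^sub>R axis i 1) has_derivative (\<lambda>h. h *\<^sub>R axis i 1)) (at 0)"
        by (auto intro!: derivative_eq_intros)
    qed (use F'[of z] in simp)
    then have "((\<lambda>h. F (z + h *\<^sub>R axis i 1)) has_vector_derivative blinfun_apply (F' z) (axis i 1)) (at 0)"
      by (simp add: has_vector_derivative_def blinfun.scaleR_right)
    then show ?thesis by (simp add: partial_deriv_def vector_derivative_at)
  qed
  have on: "onorm (blinfun_apply (F' z)) \<le> real CARD('n) * M" for z
  proof (rule onorm_le)
    fix v :: "real^'n"
    have "0 \<le> M" using norm_ge_zero M order_trans by blast
    have "blinfun_apply (F' z) v = (\<Sum>i\<in>UNIV. (v $ i) *\<^sub>R partial_deriv i F z)"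
      by (subst basis_expansion[symmetric])
        (simp add: blinfun.sum_right blinfun.scaleR_right partial scalar_mult_eq_scaleR)
    also have "norm \<dots> \<le> (\<Sum>i\<in>(UNIV::'n set). norm v * M)"
      using M \<open>0 \<le> M\<close> component_le_norm_cart[of v]
      by (intro sum_norm_le) (auto intro!: mult_mono)
    also have "\<dots> = real CARD('n) * M * norm v" by simp
    finally show "norm (blinfun_apply (F' z) v) \<le> real CARD('n) * M * norm v" .
  qed
  show ?thesis
    using differentiable_bound[of UNIV F "\<lambda>z. blinfun_apply (F' z)" "real CARD('n) * M" y x] F' on
    by auto
qed

lemma holder_on_seminorm:
  assumes "holder_on a b \<beta> f" "u \<in> {a..b}" "r \<in> {a..b}"
  shows "norm (f r - f u) \<le> holder_seminorm a b \<beta> f * \<bar>r - u\<bar> powr \<beta>"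
proof -
  obtain K where K: "\<And>\<theta> r. \<theta> \<in> {a..b} \<Longrightarrow> r \<in> {a..b} \<Longrightarrow> norm (f r - f \<theta>) \<le> K * \<bar>r - \<theta>\<bar> powr \<beta>"
    using assms(1) unfolding holder_on_def by blast
  have ordered: "norm (f r - f u) \<le> holder_seminorm a b \<beta> f * \<bar>r - u\<bar> powr \<beta>"
    if "a \<le> u" "u < r" "r \<le> b" for u r
  proof -
    have "bdd_above ((\<lambda>(\<theta>, r). norm (f r - f \<theta>) / \<bar>r - \<theta>\<bar> powr \<beta>) ` {(\<theta>, r). a \<le> \<theta> \<and> \<theta> < r \<and> r \<le> b})"
    proof (intro bdd_aboveI2[where M = K], clarify)
      fix \<theta> r assume "a \<le> \<theta>" "\<theta> < r" "r \<le> b"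
      then show "norm (f r - f \<theta>) / \<bar>r - \<theta>\<bar> powr \<beta> \<le> K"
        using K[of \<theta> r] by (simp add: divide_le_eq)
    qed
    from cSUP_upper[OF _ this, of "(u, r)"]
    have "norm (f r - f u) / \<bar>r - u\<bar> powr \<beta> \<le> holder_seminorm a b \<beta> f"
      unfolding holder_seminorm_def using that by simp
    then show ?thesis using that by (simp add: divide_le_eq)
  qed
  show ?thesis
    using ordered[of u r] ordered[of r u] assms(2,3)
    by (cases u r rule: linorder_cases) (simp_all add: norm_minus_commute abs_minus_commute)
qed

lemma holder_seminorm_le:
  assumes "a < b"
    and "\<And>u r. a \<le> u \<Longrightarrow> u < r \<Longrightarrow> r \<le> b \<Longrightarrow> norm (f r - f u) \<le> B * (r - u) powr \<beta>"
  shows "holder_seminorm a b \<beta> f \<le> B"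
  unfolding holder_seminorm_def
proof (rule cSUP_least)
  show "{(\<theta>, r). a \<le> \<theta> \<and> \<theta> < r \<and> r \<le> b} \<noteq> {}" using \<open>a < b\<close> by auto
qed (use assms(2) in \<open>auto simp: divide_le_eq\<close>)

lemma holder_seminorm_nonneg:
  assumes "holder_on a b \<beta> f" "a < b"
  shows "0 \<le> holder_seminorm a b \<beta> f"
proof -
  have "norm (f b - f a) \<le> holder_seminorm a b \<beta> f * \<bar>b - a\<bar> powr \<beta>"
    using assms by (intro holder_on_seminorm) auto
  then have "0 \<le> holder_seminorm a b \<beta> f * \<bar>b - a\<bar> powr \<beta>"
    using norm_ge_zero order_trans by blast
  then show ?thesis using assms(2) by (simp add: zero_le_mult_iff)
qed

lemma holder_on_subset:
  assumes "holder_on a b \<beta> f" "a \<le> u" "v \<le> b"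
  shows "holder_on u v \<beta> f"
proof -
  obtain K where "\<forall>\<theta>\<in>{a..b}. \<forall>r\<in>{a..b}. norm (f r - f \<theta>) \<le> K * \<bar>r - \<theta>\<bar> powr \<beta>"
    using assms(1) unfolding holder_on_def by (elim exE)
  then show ?thesis
    using assms(2,3) unfolding holder_on_def by (intro exI[of _ K]) auto
qed

section \<open>Growth of paths with controlled increments\<close>

text \<open>The a priori estimate that the equation supplies, separated from the equation. The bound for
  \<open>x\<^sub>t - x\<^sub>s\<close> still involves a Hoelder constant \<open>L\<close> of \<open>x\<close> itself, but multiplied by
  \<open>(t - s)^(2\<beta>)\<close>, so on short intervals that contribution can be absorbed. The parameter \<open>P\<close>
  will be \<open>A (1 + G)\<close>, where \<open>G\<close> is the Hoelder seminorm of the driving path.\<close>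

definition controlled_increments ::
    "real \<Rightarrow> real \<Rightarrow> real \<Rightarrow> (real \<Rightarrow> 'a::real_normed_vector) \<Rightarrow> bool" where
  "controlled_increments T \<beta> P x \<longleftrightarrow>
     (\<forall>s t L. 0 \<le> s \<and> s < t \<and> t \<le> T \<and> 0 \<le> L \<and>
        (\<forall>u\<in>{s..t}. \<forall>r\<in>{s..t}. norm (x r - x u) \<le> L * \<bar>r - u\<bar> powr \<beta>) \<longrightarrow>
        norm (x t - x s) \<le> P * (1 + norm (x s) + L * (t - s) powr \<beta>) * (t - s) powr \<beta>)"

text \<open>Absorption: with \<open>L\<close> the seminorm of \<open>x\<close> on \<open>[u, v]\<close> and \<open>D = (v - u)^\<beta>\<close>, the hypothesis
  gives \<open>L \<le> P (1 + |x\<^sub>u|) + 2 P D L\<close>, and \<open>P D \<le> 1/4\<close> leaves \<open>L \<le> 2 P (1 + |x\<^sub>u|)\<close>. The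
  argument needs \<open>L\<close> to be finite, which is why Hoelder continuity of \<open>x\<close> is assumed.\<close>

lemma controlled_increments_local:
  assumes inc: "controlled_increments T \<beta> P x" and x: "holder_on 0 T \<beta> x"
    and "0 \<le> P" "0 < \<beta>" "0 \<le> u" "u < v" "v \<le> T"
    and small: "P * (v - u) powr \<beta> \<le> 1 / 4"
  shows "norm (x v - x u) \<le> 2 * P * (1 + norm (x u)) * (v - u) powr \<beta>"
proof -
  define L where "L = holder_seminorm u v \<beta> x"
  define D where "D = (v - u) powr \<beta>"
  have x': "holder_on u v \<beta> x" using holder_on_subset x \<open>0 \<le> u\<close> \<open>v \<le> T\<close> .
  have "L \<ge> 0" unfolding L_def using holder_seminorm_nonneg x' \<open>u < v\<close> .
  have L: "norm (x r - x s) \<le> L * \<bar>r - s\<bar> powr \<beta>" if "s \<in> {u..v}" "r \<in> {u..v}" for s r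
    unfolding L_def using holder_on_seminorm[OF x' that] .
  have mono: "\<bar>r - s\<bar> powr \<beta> \<le> D" if "s \<in> {u..v}" "r \<in> {u..v}" for s r
    unfolding D_def using that \<open>0 < \<beta>\<close> by (intro powr_mono2) auto
  have "L \<le> P * (1 + norm (x u) + 2 * (L * D))"
    unfolding L_def
  proof (rule holder_seminorm_le[OF \<open>u < v\<close>], fold L_def)
    fix s t assume st: "u \<le> s" "s < t" "t \<le> v"
    have "norm (x t - x s) \<le> P * (1 + norm (x s) + L * (t - s) powr \<beta>) * (t - s) powr \<beta>"
      using inc[unfolded controlled_increments_def, rule_format, of s t L] st L \<open>L \<ge> 0\<close> assms
      by auto
    also have "\<dots> \<le> P * (1 + norm (x u) + 2 * (L * D)) * (t - s) powr \<beta>"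
    proof (intro mult_right_mono mult_left_mono)
      have "norm (x s) \<le> norm (x u) + norm (x s - x u)" using norm_triangle_sub by blast
      also have "norm (x s - x u) \<le> L * \<bar>s - u\<bar> powr \<beta>" using L[of u s] st by simp
      also have "\<dots> \<le> L * D" using mono[of u s] st \<open>L \<ge> 0\<close> by (intro mult_left_mono) auto
      finally have "norm (x s) \<le> norm (x u) + L * D" by simp
      moreover have "L * (t - s) powr \<beta> \<le> L * D"
        using mono[of s t] st \<open>L \<ge> 0\<close> by (intro mult_left_mono) auto
      ultimately show "1 + norm (x s) + L * (t - s) powr \<beta> \<le> 1 + norm (x u) + 2 * (L * D)" by simp
    qed (use \<open>0 \<le> P\<close> in auto)
    finally show "norm (x t - x s) \<le> P * (1 + norm (x u) + 2 * (L * D)) * (t - s) powr \<beta>" .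
  qed
  also have "\<dots> = P * (1 + norm (x u)) + 2 * L * (P * D)" by (simp add: algebra_simps)
  also have "\<dots> \<le> P * (1 + norm (x u)) + 2 * L * (1 / 4)"
    using small \<open>L \<ge> 0\<close> by (intro add_left_mono mult_left_mono) (auto simp: D_def)
  finally have "L \<le> 2 * P * (1 + norm (x u))" by simp
  then have "L * (v - u) powr \<beta> \<le> 2 * P * (1 + norm (x u)) * (v - u) powr \<beta>"
    by (intro mult_right_mono) auto
  moreover have "norm (x v - x u) \<le> L * (v - u) powr \<beta>" using L[of u v] \<open>u < v\<close> by simp
  ultimately show ?thesis by simp
qed

text \<open>The local estimate applies on intervals of length \<open>1/R\<close> with \<open>R = (4P)^(1/\<beta>)\<close>, and there
  \<open>1 + |x|\<close> at most doubles. About \<open>T R\<close> such steps reach the end of \<open>[0, T]\<close>, so the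
  growth factor is exponential in \<open>P^(1/\<beta>)\<close>. For increments over longer times the supremum
  bound is enough, because then \<open>4 P (v - u)^\<beta> \<ge> 1\<close>.\<close>

lemma controlled_increments_growth:
  assumes inc: "controlled_increments T \<beta> P x" and x: "holder_on 0 T \<beta> x"
    and "0 < P" "0 < \<beta>" "0 < T"
  defines "S \<equiv> 2 * exp (T * (4 * P) powr (1 / \<beta>)) * (1 + norm (x 0))"
  shows "\<forall>t\<in>{0..T}. 1 + norm (x t) \<le> S"
    and "holder_seminorm 0 T \<beta> x \<le> 8 * P * S"
proof -
  define R where "R = (4 * P) powr (1 / \<beta>)"
  have "R > 0" using \<open>0 < P\<close> by (simp add: R_def)
  have R: "(1 / R) powr \<beta> = 1 / (4 * P)"
    using \<open>0 < P\<close> \<open>0 < \<beta>\<close> by (simp add: R_def powr_divide powr_powr)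
  have short: "norm (x v - x u) \<le> 2 * P * (1 + norm (x u)) * (v - u) powr \<beta>"
    and mesh: "P * (v - u) powr \<beta> \<le> 1 / 4"
    if "0 \<le> u" "u < v" "v \<le> T" "v - u \<le> 1 / R" for u v
  proof -
    have "(v - u) powr \<beta> \<le> (1 / R) powr \<beta>" using that \<open>0 < \<beta>\<close> by (intro powr_mono2) auto
    then show m: "P * (v - u) powr \<beta> \<le> 1 / 4"
      using \<open>0 < P\<close> unfolding R by (simp add: field_simps)
    show "norm (x v - x u) \<le> 2 * P * (1 + norm (x u)) * (v - u) powr \<beta>"
      using controlled_increments_local[OF inc x _ _ that(1-3) m] \<open>0 < P\<close> \<open>0 < \<beta>\<close> by simp
  qed
  have double: "1 + norm (x v) \<le> 2 * (1 + norm (x u))"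
    if "0 \<le> u" "u \<le> v" "v \<le> T" "v - u \<le> 1 / R" for u v
  proof (cases "u = v")
    case False
    then have uv: "u < v" using that by simp
    have "norm (x v) \<le> norm (x u) + norm (x v - x u)" using norm_triangle_sub by blast
    also have "norm (x v - x u) \<le> 2 * (1 + norm (x u)) * (P * (v - u) powr \<beta>)"
      using short[OF that(1) uv that(3,4)] by (simp add: mult_ac)
    also have "\<dots> \<le> 2 * (1 + norm (x u)) * (1 / 4)"
      using mesh[OF that(1) uv that(3,4)] by (intro mult_left_mono) auto
    finally have "norm (x v) \<le> norm (x u) + 2 * (1 + norm (x u)) * (1 / 4)" by simp
    then show ?thesis using norm_ge_zero[of "x u"] by argo
  qed simp
  have iterate: "1 + norm (x t) \<le> 2 ^ k * (1 + norm (x 0))"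
    if "0 \<le> t" "t \<le> T" "t \<le> real k * (1 / R)" for k t
    using that
  proof (induction k arbitrary: t)
    case (Suc k)
    \<comment> \<open>One step of length \<open>1 / R\<close> back from \<open>t\<close>, stopped at the initial time.\<close>
    define s where "s = max 0 (t - 1 / R)"
    have s: "0 \<le> s" "s \<le> t" "t - s \<le> 1 / R" "s \<le> real k * (1 / R)"
      using Suc.prems \<open>R > 0\<close> by (auto simp: s_def add_divide_distrib)
    have "1 + norm (x t) \<le> 2 * (1 + norm (x s))" using double s Suc.prems by auto
    also have "\<dots> \<le> 2 * (2 ^ k * (1 + norm (x 0)))"
      using Suc.IH[of s] s Suc.prems by (intro mult_left_mono) auto
    finally show ?case by simp
  qed simp
  define k where "k = nat \<lceil>T * R\<rceil>"
  have TR: "0 \<le> T * R" using \<open>0 < T\<close> \<open>R > 0\<close> by simp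
  have k: "T * R \<le> real k" "real k \<le> T * R + 1"
    using TR by (auto simp: k_def of_nat_nat)
  have "(2::real) ^ k = 2 powr real k" by (simp add: powr_realpow)
  also have "\<dots> \<le> 2 powr (T * R + 1)" using k by (intro powr_mono) auto
  also have "\<dots> = 2 * 2 powr (T * R)" by (simp add: powr_add)
  also have "2 powr (T * R) \<le> exp (T * R)"
    using TR ln_2_less_1 by (simp add: powr_def mult_left_le)
  finally have pow: "2 ^ k \<le> 2 * exp (T * R)" by simp
  show sup: "\<forall>t\<in>{0..T}. 1 + norm (x t) \<le> S"
  proof
    fix t assume t: "t \<in> {0..T}"
    have "t * R \<le> T * R" using t \<open>R > 0\<close> by simp
    then have "t * R \<le> real k" using k(1) by linarith
    then have "t \<le> real k * (1 / R)" using \<open>R > 0\<close> by (simp add: field_simps)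
    then have "1 + norm (x t) \<le> 2 ^ k * (1 + norm (x 0))" using iterate t by auto
    also have "\<dots> \<le> S" unfolding S_def R_def[symmetric] using pow by (intro mult_right_mono) auto
    finally show "1 + norm (x t) \<le> S" .
  qed
  show "holder_seminorm 0 T \<beta> x \<le> 8 * P * S"
  proof (rule holder_seminorm_le[OF \<open>0 < T\<close>])
    fix u v assume uv: "0 \<le> u" "u < v" "v \<le> T"
    have "S \<ge> 0" by (simp add: S_def)
    show "norm (x v - x u) \<le> 8 * P * S * (v - u) powr \<beta>"
    proof (cases "v - u \<le> 1 / R")
      case True
      have "norm (x v - x u) \<le> 2 * P * (1 + norm (x u)) * (v - u) powr \<beta>" using short uv True .
      also have "\<dots> \<le> 8 * P * S * (v - u) powr \<beta>"
        using sup uv \<open>0 < P\<close> by (intro mult_right_mono mult_mono) auto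
      finally show ?thesis .
    next
      case False
      then have "(1 / R) powr \<beta> \<le> (v - u) powr \<beta>"
        using \<open>0 < \<beta>\<close> \<open>R > 0\<close> by (intro powr_mono2) auto
      then have *: "1 \<le> 4 * P * (v - u) powr \<beta>" unfolding R using \<open>0 < P\<close> by (simp add: field_simps)
      have "norm (x v - x u) \<le> norm (x v) + norm (x u)" by (rule norm_triangle_ineq4)
      also have "\<dots> \<le> 2 * S * 1" using sup[rule_format, of u] sup[rule_format, of v] uv by simp
      also have "\<dots> \<le> 2 * S * (4 * P * (v - u) powr \<beta>)"
        using * \<open>S \<ge> 0\<close> by (intro mult_left_mono) auto
      finally show ?thesis by (simp add: mult_ac)
    qed
  qed
qed

section \<open>A priori estimate for solutions\<close>

text \<open>Increments of \<open>r \<mapsto> \<sigma> r (x r)\<close> have a \<open>\<gamma>\<close>-Hoelder part from the time variable and a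
  \<open>\<beta>\<close>-Hoelder part from \<open>x\<close>. On \<open>[s, t]\<close> both are Hoelder with the smaller exponent \<open>\<rho> = min \<gamma> \<beta>\<close>, with
  constants scaled by \<open>(t - s)^(\<gamma> - \<rho>)\<close> and \<open>(t - s)^(\<beta> - \<rho>)\<close>. These factors restore the
  original exponents in the Young--Loeve remainder, so that \<open>L\<close> appears with the full power
  \<open>(t - s)^(2\<beta>)\<close>; with a smaller power the final bound would not have the exponent \<open>1/\<beta>\<close>.\<close>

lemma rs_integral_increment:
  fixes \<sigma> :: "real \<Rightarrow> 'b::real_normed_vector \<Rightarrow> 'a::real_normed_vector"
  assumes int: "rs_integrable (\<lambda>r. \<sigma> r (x r)) g 0 s" "rs_integrable (\<lambda>r. \<sigma> r (x r)) g 0 t"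
    and st: "0 \<le> s" "s < t" "t \<le> T"
    and time: "\<And>r u y. r \<in> {0..T} \<Longrightarrow> u \<in> {0..T} \<Longrightarrow> norm (\<sigma> r y - \<sigma> u y) \<le> M * \<bar>r - u\<bar> powr \<gamma>"
    and lip: "\<And>r y z. r \<in> {0..T} \<Longrightarrow> norm (\<sigma> r y - \<sigma> r z) \<le> \<Lambda> * norm (y - z)"
    and growth: "\<And>r y. r \<in> {0..T} \<Longrightarrow> norm (\<sigma> r y) \<le> M * (1 + norm y)"
    and g: "\<And>r u. r \<in> {0..T} \<Longrightarrow> u \<in> {0..T} \<Longrightarrow> \<bar>g r - g u\<bar> \<le> G * \<bar>r - u\<bar> powr \<beta>"
    and x: "\<And>r u. r \<in> {s..t} \<Longrightarrow> u \<in> {s..t} \<Longrightarrow> norm (x r - x u) \<le> L * \<bar>r - u\<bar> powr \<beta>"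
    and nonneg: "0 \<le> M" "0 \<le> \<Lambda>" "0 \<le> G" "0 \<le> L" "0 \<le> \<gamma>"
    and exps: "1 < \<gamma> + \<beta>" "1 < 2 * \<beta>"
  defines "\<kappa> \<equiv> young_loeve_const (min \<gamma> \<beta> + \<beta>)"
  shows "norm (rs_integral (\<lambda>r. \<sigma> r (x r)) g 0 t - rs_integral (\<lambda>r. \<sigma> r (x r)) g 0 s)
    \<le> (M + \<kappa> * (M * T powr \<gamma> + \<Lambda>)) * G * (1 + norm (x s) + L * (t - s) powr \<beta>) * (t - s) powr \<beta>"
proof -
  define f where "f \<equiv> \<lambda>r. \<sigma> r (x r)"
  define \<rho> where "\<rho> = min \<gamma> \<beta>"
  define d where "d = t - s"
  define X where "X = 1 + norm (x s) + L * d powr \<beta>"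
  define F where "F = M * d powr (\<gamma> - \<rho>) + \<Lambda> * L * d powr (\<beta> - \<rho>)"
  have \<rho>: "\<rho> \<le> \<gamma>" "\<rho> \<le> \<beta>" "1 < \<rho> + \<beta>" using exps by (auto simp: \<rho>_def)
  have "\<kappa> \<ge> 0"
    unfolding \<kappa>_def using exps by (intro young_loeve_const_nonneg) auto
  have "d > 0" using st by (simp add: d_def)
  have "F \<ge> 0" using nonneg by (simp add: F_def)
  have "X \<ge> 0" using nonneg by (simp add: X_def)
  from int[folded f_def, unfolded rs_integrable_def]
  obtain I J where IJ: "has_rs_integral f g 0 t I" "has_rs_integral f g 0 s J"
    by (elim exE)
  have diff: "rs_integral f g 0 t - rs_integral f g 0 s = I - J"
    using IJ st by (simp add: rs_integral_eqI)
  have scale: "\<bar>r - u\<bar> powr \<eta> \<le> d powr (\<eta> - \<rho>) * \<bar>r - u\<bar> powr \<rho>"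
    if "r \<in> {s..t}" "u \<in> {s..t}" "\<rho> \<le> \<eta>" for r u \<eta>
  proof -
    have "\<bar>r - u\<bar> powr \<eta> = \<bar>r - u\<bar> powr (\<eta> - \<rho>) * \<bar>r - u\<bar> powr \<rho>"
      by (simp flip: powr_add)
    also have "\<dots> \<le> d powr (\<eta> - \<rho>) * \<bar>r - u\<bar> powr \<rho>"
      using that by (intro mult_right_mono powr_mono2) (auto simp: d_def)
    finally show ?thesis .
  qed
  have F: "norm (f r - f u) \<le> F * \<bar>r - u\<bar> powr \<rho>" if ru: "u \<in> {s..t}" "r \<in> {s..t}" for u r
  proof -
    have "norm (f r - f u) = norm ((\<sigma> r (x r) - \<sigma> u (x r)) + (\<sigma> u (x r) - \<sigma> u (x u)))"
      by (simp add: f_def)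
    also have "\<dots> \<le> norm (\<sigma> r (x r) - \<sigma> u (x r)) + norm (\<sigma> u (x r) - \<sigma> u (x u))"
      by (rule norm_triangle_ineq)
    also have "\<dots> \<le> M * \<bar>r - u\<bar> powr \<gamma> + \<Lambda> * norm (x r - x u)"
      using ru st by (intro add_mono time lip) auto
    also have "\<dots> \<le> M * \<bar>r - u\<bar> powr \<gamma> + \<Lambda> * (L * \<bar>r - u\<bar> powr \<beta>)"
      using x[of r u] ru nonneg by (intro add_left_mono mult_left_mono) auto
    also have "\<dots> \<le> M * (d powr (\<gamma> - \<rho>) * \<bar>r - u\<bar> powr \<rho>)
        + \<Lambda> * (L * (d powr (\<beta> - \<rho>) * \<bar>r - u\<bar> powr \<rho>))"
      using ru nonneg \<rho> by (intro add_mono mult_left_mono scale) auto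
    also have "\<dots> = F * \<bar>r - u\<bar> powr \<rho>" by (simp add: F_def algebra_simps)
    finally show ?thesis .
  qed
  have "norm (I - J - (g t - g s) *\<^sub>R f s) \<le> \<kappa> * (F * G * d powr (\<rho> + \<beta>))"
    unfolding \<kappa>_def \<rho>_def[symmetric] d_def
  proof (rule young_loeve_estimate)
    show "has_rs_integral f g s t (I - J)" by (rule has_rs_integral_diff[OF IJ]) (use st in auto)
    show "\<bar>g r - g u\<bar> \<le> G * \<bar>r - u\<bar> powr \<beta>" if "u \<in> {s..t}" "r \<in> {s..t}" for u r
      using g that st by auto
  qed (use F \<open>F \<ge> 0\<close> nonneg \<rho> st in auto)
  also have "F * G * d powr (\<rho> + \<beta>) = G * d powr \<beta> * (M * d powr \<gamma> + \<Lambda> * (L * d powr \<beta>))"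
  proof -
    have "F * d powr \<rho> = M * d powr \<gamma> + \<Lambda> * (L * d powr \<beta>)"
      by (simp add: F_def distrib_right mult.assoc flip: powr_add)
    then show ?thesis by (simp add: powr_add mult_ac)
  qed
  also have "\<kappa> * \<dots> \<le> \<kappa> * (G * d powr \<beta> * ((M * T powr \<gamma> + \<Lambda>) * X))"
  proof (intro mult_left_mono)
    have "M * d powr \<gamma> \<le> M * T powr \<gamma> * X"
    proof -
      have "d powr \<gamma> \<le> T powr \<gamma>" using \<open>d > 0\<close> st nonneg by (intro powr_mono2) (auto simp: d_def)
      moreover have "X \<ge> 1" using nonneg by (simp add: X_def)
      ultimately have "d powr \<gamma> * 1 \<le> T powr \<gamma> * X" by (intro mult_mono) auto
      then show ?thesis using nonneg by (simp add: mult_left_mono mult.assoc)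
    qed
    moreover have "\<Lambda> * (L * d powr \<beta>) \<le> \<Lambda> * X"
      using nonneg by (intro mult_left_mono) (auto simp: X_def)
    ultimately show "M * d powr \<gamma> + \<Lambda> * (L * d powr \<beta>) \<le> (M * T powr \<gamma> + \<Lambda>) * X"
      by (simp add: distrib_right)
  qed (use \<open>\<kappa> \<ge> 0\<close> nonneg in auto)
  finally have remainder: "norm (I - J - (g t - g s) *\<^sub>R f s) \<le> \<kappa> * (G * d powr \<beta> * ((M * T powr \<gamma> + \<Lambda>) * X))" .
  have "norm ((g t - g s) *\<^sub>R f s) \<le> (G * d powr \<beta>) * (M * X)"
  proof -
    have "\<bar>g t - g s\<bar> \<le> G * d powr \<beta>" using g[of t s] st by (simp add: d_def)
    moreover have "norm (f s) \<le> M * X"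
    proof -
      have "norm (f s) \<le> M * (1 + norm (x s))" using growth st by (simp add: f_def)
      also have "\<dots> \<le> M * X" using nonneg by (intro mult_left_mono) (auto simp: X_def)
      finally show ?thesis .
    qed
    ultimately show ?thesis using nonneg by (auto intro!: mult_mono)
  qed
  with remainder have "norm (I - J) \<le> (G * d powr \<beta>) * (M * X) + \<kappa> * (G * d powr \<beta> * ((M * T powr \<gamma> + \<Lambda>) * X))"
    using norm_triangle_sub[of "I - J" "(g t - g s) *\<^sub>R f s"] by linarith
  also have "\<dots> = (M + \<kappa> * (M * T powr \<gamma> + \<Lambda>)) * G * X * d powr \<beta>" by (simp add: algebra_simps)
  finally show ?thesis using diff by (simp add: f_def X_def d_def)
qed

lemma integral_increment:
  fixes b :: "real \<Rightarrow> 'b::real_normed_vector \<Rightarrow> 'a::euclidean_space"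
  assumes int: "(\<lambda>r. b r (x r)) integrable_on {0..t}"
    and st: "0 \<le> s" "s < t" "t \<le> T"
    and growth: "\<And>r y. r \<in> {0..T} \<Longrightarrow> norm (b r y) \<le> M * (1 + norm y)"
    and x: "\<And>r u. r \<in> {s..t} \<Longrightarrow> u \<in> {s..t} \<Longrightarrow> norm (x r - x u) \<le> L * \<bar>r - u\<bar> powr \<beta>"
    and nonneg: "0 \<le> M" "0 \<le> L" "0 \<le> \<beta>" "\<beta> \<le> 1"
  shows "norm (integral {0..t} (\<lambda>r. b r (x r)) - integral {0..s} (\<lambda>r. b r (x r)))
    \<le> M * T powr (1 - \<beta>) * (1 + norm (x s) + L * (t - s) powr \<beta>) * (t - s) powr \<beta>"
proof -
  define X where "X = 1 + norm (x s) + L * (t - s) powr \<beta>"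
  have "X \<ge> 0" using nonneg by (simp add: X_def)
  have bound: "norm (b r (x r)) \<le> M * X" if r: "r \<in> {s..t}" for r
  proof -
    have "norm (x r) \<le> norm (x s) + norm (x r - x s)" using norm_triangle_sub by blast
    also have "norm (x r - x s) \<le> L * \<bar>r - s\<bar> powr \<beta>" using x[of r s] r st by simp
    also have "\<dots> \<le> L * (t - s) powr \<beta>" using r nonneg by (intro mult_left_mono powr_mono2) auto
    finally have "M * (1 + norm (x r)) \<le> M * X" using nonneg by (intro mult_left_mono) (auto simp: X_def)
    moreover have "norm (b r (x r)) \<le> M * (1 + norm (x r))" using growth r st by auto
    ultimately show ?thesis by simp
  qed
  have sub: "(\<lambda>r. b r (x r)) integrable_on {s..t}"
    using integrable_on_subinterval[OF int] st by auto
  have "integral {0..t} (\<lambda>r. b r (x r)) - integral {0..s} (\<lambda>r. b r (x r)) = integral {s..t} (\<lambda>r. b r (x r))"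
    using Henstock_Kurzweil_Integration.integral_combine[of 0 s t "\<lambda>r. b r (x r)"] st int
    by (simp add: algebra_simps)
  also have "norm \<dots> \<le> M * X * measure lborel {s..t}"
    using bound nonneg \<open>X \<ge> 0\<close> sub
    by (intro has_integral_bound_real[where S = "{}"]) auto
  also have "\<dots> = M * X * ((t - s) powr (1 - \<beta>) * (t - s) powr \<beta>)"
    using st by (simp flip: powr_add)
  also have "\<dots> \<le> M * X * (T powr (1 - \<beta>) * (t - s) powr \<beta>)"
    using st nonneg \<open>X \<ge> 0\<close> by (intro mult_left_mono mult_right_mono powr_mono2) auto
  finally show ?thesis by (simp add: X_def mult_ac)
qed

lemma solution_initial_value:
  assumes "solves_equation T \<beta> b \<sigma> g x\<^sub>0 x" "0 \<le> T"
  shows "x 0 = x\<^sub>0"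
  using assms unfolding solves_equation_def by (simp add: rs_integral_degenerate)

text \<open>The drift is bounded by \<open>M Y (t - s) \<le> M T^(1 - \<beta>) Y (t - s)^\<beta>\<close> and each integral
  against a component of \<open>g\<close> by a multiple of \<open>G Y (t - s)^\<beta>\<close>, where
  \<open>Y = 1 + |x\<^sub>s| + L (t - s)^\<beta>\<close> dominates \<open>1 + |x|\<close> on \<open>[s, t]\<close>. The constant \<open>A\<close> collects the factors that do not involve \<open>g\<close>.\<close>

lemma solution_controlled_increments:
  fixes b :: "real \<Rightarrow> real^'n \<Rightarrow> real^'n" and \<sigma> :: "'m::finite \<Rightarrow> real \<Rightarrow> real^'n \<Rightarrow> real^'n"
  assumes sol: "solves_equation T \<beta> b \<sigma> g x\<^sub>0 x"
    and drift: "\<And>t y. t \<in> {0..T} \<Longrightarrow> norm (b t y) \<le> M * (1 + norm y)"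
    and growth: "\<And>j t y. t \<in> {0..T} \<Longrightarrow> norm (\<sigma> j t y) \<le> M * (1 + norm y)"
    and time: "\<And>j t s y. t \<in> {0..T} \<Longrightarrow> s \<in> {0..T} \<Longrightarrow> norm (\<sigma> j t y - \<sigma> j s y) \<le> M * \<bar>t - s\<bar> powr \<gamma>"
    and lip: "\<And>j t y z. t \<in> {0..T} \<Longrightarrow> norm (\<sigma> j t y - \<sigma> j t z) \<le> \<Lambda> * norm (y - z)"
    and g: "\<And>t s. t \<in> {0..T} \<Longrightarrow> s \<in> {0..T} \<Longrightarrow> norm (g t - g s) \<le> G * \<bar>t - s\<bar> powr \<beta>"
    and nonneg: "0 \<le> M" "0 \<le> \<Lambda>" "0 \<le> G" "0 \<le> \<gamma>"
    and exps: "1 < \<gamma> + \<beta>" "1 < 2 * \<beta>" "\<beta> \<le> 1"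
  defines "\<kappa> \<equiv> young_loeve_const (min \<gamma> \<beta> + \<beta>)"
  defines "A \<equiv> M * T powr (1 - \<beta>) + real CARD('m) * (M + \<kappa> * (M * T powr \<gamma> + \<Lambda>))"
  shows "controlled_increments T \<beta> (A * (1 + G)) x"
  unfolding controlled_increments_def
proof (intro allI impI, elim conjE)
  fix s t L
  assume st: "0 \<le> s" "s < t" "t \<le> T" and "0 \<le> L"
    and L: "\<forall>u\<in>{s..t}. \<forall>r\<in>{s..t}. norm (x r - x u) \<le> L * \<bar>r - u\<bar> powr \<beta>"
  define B where "B = M + \<kappa> * (M * T powr \<gamma> + \<Lambda>)"
  define X where "X = (1 + norm (x s) + L * (t - s) powr \<beta>) * (t - s) powr \<beta>"
  define D where "D \<equiv> \<lambda>t. integral {0..t} (\<lambda>s. b s (x s))"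
  define S where "S \<equiv> \<lambda>j t. rs_integral (\<lambda>s. \<sigma> j s (x s)) (\<lambda>s. g s $ j) 0 t"
  have "X \<ge> 0" using \<open>0 \<le> L\<close> by (simp add: X_def)
  have "\<kappa> \<ge> 0"
    unfolding \<kappa>_def using exps by (intro young_loeve_const_nonneg) auto
  then have "B \<ge> 0" using nonneg by (simp add: B_def)
  have eq: "x r = x\<^sub>0 + D r + (\<Sum>j\<in>UNIV. S j r)"
    and D_int: "(\<lambda>s. b s (x s)) integrable_on {0..r}"
    and S_int: "rs_integrable (\<lambda>s. \<sigma> j s (x s)) (\<lambda>s. g s $ j) 0 r"
    if "r \<in> {0..T}" for r j
    using sol that unfolding solves_equation_def D_def S_def by blast+
  have "norm (D t - D s) \<le> M * T powr (1 - \<beta>) * (1 + norm (x s) + L * (t - s) powr \<beta>) * (t - s) powr \<beta>"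
    unfolding D_def
  proof (rule integral_increment[where b = b and x = x and T = T])
    show "(\<lambda>s. b s (x s)) integrable_on {0..t}" using D_int st by simp
  qed (use L st drift nonneg \<open>0 \<le> L\<close> exps in auto)
  then have D: "norm (D t - D s) \<le> M * T powr (1 - \<beta>) * X"
    by (simp add: X_def mult.assoc)
  have S: "norm (S j t - S j s) \<le> B * G * X" for j
  proof -
    have "norm (S j t - S j s) \<le> B * G * (1 + norm (x s) + L * (t - s) powr \<beta>) * (t - s) powr \<beta>"
      unfolding S_def B_def \<kappa>_def
    proof (rule rs_integral_increment[where \<sigma> = "\<sigma> j" and x = x and T = T])
      show "\<bar>g r $ j - g u $ j\<bar> \<le> G * \<bar>r - u\<bar> powr \<beta>" if "r \<in> {0..T}" "u \<in> {0..T}" for r u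
        using component_le_norm_cart[of "g r - g u" j] g[OF that] by simp
    next
      show "rs_integrable (\<lambda>s. \<sigma> j s (x s)) (\<lambda>s. g s $ j) 0 s"
        and "rs_integrable (\<lambda>s. \<sigma> j s (x s)) (\<lambda>s. g s $ j) 0 t" using S_int st by simp_all
    qed (use st time lip growth L nonneg \<open>0 \<le> L\<close> exps in auto)
    then show ?thesis by (simp add: X_def mult.assoc)
  qed
  have "x t - x s = (D t - D s) + (\<Sum>j\<in>UNIV. S j t - S j s)"
    using eq[of t] eq[of s] st by (simp add: sum_subtractf)
  then have "norm (x t - x s) \<le> norm (D t - D s) + norm (\<Sum>j\<in>UNIV. S j t - S j s)"
    using norm_triangle_ineq by metis
  also have "\<dots> \<le> M * T powr (1 - \<beta>) * X + (\<Sum>j\<in>(UNIV::'m set). B * G * X)"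
    using D S by (intro add_mono sum_norm_le) auto
  also have "\<dots> = (M * T powr (1 - \<beta>) + real CARD('m) * B * G) * X"
    by (simp add: algebra_simps)
  also have "\<dots> \<le> (A * (1 + G)) * X"
  proof (rule mult_right_mono)
    have *: "c + d * G \<le> (c + d) * (1 + G)" if "0 \<le> c" "0 \<le> d" for c d :: real
    proof -
      have "(c + d) * (1 + G) = c + d * G + (c * G + d)" by (simp add: algebra_simps)
      moreover have "0 \<le> c * G" using that nonneg by simp
      ultimately show ?thesis using that by linarith
    qed
    show "M * T powr (1 - \<beta>) + real CARD('m) * B * G \<le> A * (1 + G)"
      unfolding A_def B_def[symmetric] by (rule *) (use nonneg \<open>B \<ge> 0\<close> in simp_all)
  qed fact
  finally show "norm (x t - x s) \<le> A * (1 + G) * (1 + norm (x s) + L * (t - s) powr \<beta>) * (t - s) powr \<beta>"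
    by (simp add: X_def mult.assoc)
qed

section \<open>Exponential bounds\<close>

text \<open>The exponent \<open>P^(1/\<beta>)\<close> with \<open>P = A (1 + G)\<close> is at most a constant plus a multiple of
  \<open>G^(1/\<beta>)\<close> because \<open>1 + G \<le> 2 max 1 G\<close>, and the power of a maximum is the maximum of the powers.
  The polynomial factor \<open>1 + G\<close> is harmless because \<open>G \<le> G^(1/\<beta>)\<close> for \<open>G \<ge> 1\<close>.\<close>

lemma absorb_noise_into_exponential:
  fixes A G T \<beta> :: real
  assumes "0 < A" "0 \<le> G" "0 < \<beta>" "\<beta> \<le> 1" "0 \<le> T"
  defines "\<mu> \<equiv> T * (8 * A) powr (1 / \<beta>)"
  shows "exp (T * (4 * (A * (1 + G))) powr (1 / \<beta>)) \<le> exp \<mu> * exp (\<mu> * G powr (1 / \<beta>))"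
    and "1 + G \<le> 2 * exp (G powr (1 / \<beta>))"
proof -
  have "(4 * (A * (1 + G))) powr (1 / \<beta>) \<le> (8 * A * max 1 G) powr (1 / \<beta>)"
    using assms by (intro powr_mono2) (auto simp: max_def)
  also have "\<dots> = (8 * A) powr (1 / \<beta>) * max 1 G powr (1 / \<beta>)"
    using assms by (simp add: powr_mult)
  also have "max 1 G powr (1 / \<beta>) \<le> 1 + G powr (1 / \<beta>)"
    by (simp add: max_def)
  finally have "T * (4 * (A * (1 + G))) powr (1 / \<beta>) \<le> T * ((8 * A) powr (1 / \<beta>) * (1 + G powr (1 / \<beta>)))"
    using assms by (simp add: mult_left_mono)
  also have "\<dots> = \<mu> + \<mu> * G powr (1 / \<beta>)" by (simp add: \<mu>_def algebra_simps)
  finally show "exp (T * (4 * (A * (1 + G))) powr (1 / \<beta>)) \<le> exp \<mu> * exp (\<mu> * G powr (1 / \<beta>))"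
    by (simp flip: exp_add)
  have "G \<le> 1 + G powr (1 / \<beta>)"
  proof (cases "G \<le> 1")
    case False
    then have "G powr 1 \<le> G powr (1 / \<beta>)" using assms by (intro powr_mono) auto
    then show ?thesis using False by simp
  qed (simp add: add_increasing2)
  moreover have "1 + G powr (1 / \<beta>) \<le> exp (G powr (1 / \<beta>))" by (rule exp_ge_add_one_self)
  moreover have "1 \<le> exp (G powr (1 / \<beta>))" by simp
  ultimately show "1 + G \<le> 2 * exp (G powr (1 / \<beta>))" by linarith
qed

lemma controlled_increments_exponential_bounds:
  assumes inc: "controlled_increments T \<beta> (A * (1 + G)) x" and x: "holder_on 0 T \<beta> x"
    and "0 < A" "0 \<le> G" "0 < \<beta>" "\<beta> \<le> 1" "0 < T"
  defines "\<mu> \<equiv> T * (8 * A) powr (1 / \<beta>)"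
  defines "E \<equiv> (2 + 32 * A) * exp \<mu> * exp ((\<mu> + 1) * G powr (1 / \<beta>)) * (norm (x 0) + 1)"
  shows "(SUP t\<in>{0..T}. norm (x t)) \<le> E" and "holder_seminorm 0 T \<beta> x \<le> E"
proof -
  define P where "P = A * (1 + G)"
  define S where "S = 2 * exp (T * (4 * P) powr (1 / \<beta>)) * (1 + norm (x 0))"
  define Z where "Z = exp \<mu> * exp (\<mu> * G powr (1 / \<beta>)) * (norm (x 0) + 1)"
  define e where "e = exp (G powr (1 / \<beta>))"
  have "P > 0" using assms by (simp add: P_def)
  have "e \<ge> 1" by (simp add: e_def)
  have "Z \<ge> 0" by (simp add: Z_def)
  \<comment> \<open>With \<open>S \<le> 2 Z\<close> and \<open>P \<le> 2 A e\<close>, the two parts of \<open>2 + 32 A\<close> pay for the bounds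
    \<open>S\<close> and \<open>8 P S\<close> on the supremum and on the seminorm.\<close>
  have E: "E = (2 + 32 * A) * (e * Z)"
    by (simp add: E_def Z_def e_def distrib_right exp_add)
  note bounds = controlled_increments_growth[OF inc[folded P_def] x \<open>P > 0\<close> \<open>0 < \<beta>\<close> \<open>0 < T\<close>, folded S_def]
  have SZ: "S \<le> 2 * Z"
    using mult_right_mono[OF absorb_noise_into_exponential(1)[of A G \<beta> T], of "1 + norm (x 0)"] assms(3-7)
    by (simp add: S_def Z_def P_def \<mu>_def add.commute)
  have "2 * Z \<le> 2 * (e * Z)" using \<open>e \<ge> 1\<close> \<open>Z \<ge> 0\<close> mult_right_mono[of 1 e Z] by simp
  moreover have "0 \<le> 32 * A * (e * Z)" using \<open>0 < A\<close> \<open>e \<ge> 1\<close> \<open>Z \<ge> 0\<close> by simp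
  ultimately have "S \<le> E" using SZ unfolding E distrib_right by linarith
  show "(SUP t\<in>{0..T}. norm (x t)) \<le> E"
  proof (rule cSUP_least)
    fix t assume "t \<in> {0..T}"
    then have "1 + norm (x t) \<le> S" using bounds(1) by blast
    then show "norm (x t) \<le> E" using \<open>S \<le> E\<close> by simp
  qed (use \<open>0 < T\<close> in auto)
  have "holder_seminorm 0 T \<beta> x \<le> 8 * P * S" by (rule bounds(2))
  also have "\<dots> \<le> 8 * P * (2 * Z)" using SZ \<open>P > 0\<close> by (intro mult_left_mono) auto
  also have "P \<le> A * (2 * e)"
    unfolding P_def e_def using absorb_noise_into_exponential(2)[of A G \<beta> T] assms(3-7)
    by (intro mult_left_mono) auto
  then have "8 * P * (2 * Z) \<le> 8 * (A * (2 * e)) * (2 * Z)"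
    using \<open>Z \<ge> 0\<close> by (intro mult_right_mono) auto
  also have "\<dots> \<le> E" using \<open>e \<ge> 1\<close> \<open>Z \<ge> 0\<close> by (simp add: E algebra_simps)
  finally show "holder_seminorm 0 T \<beta> x \<le> E" .
qed

theorem lemma4p2:
  fixes H \<alpha> \<beta> \<gamma> T :: real
    and b :: "real \<Rightarrow> real \<Rightarrow> real^'n \<Rightarrow> real^'n"
    and \<sigma> :: "'m::finite \<Rightarrow> real \<Rightarrow> real \<Rightarrow> real^'n \<Rightarrow> real^'n"
  assumes "1/2 < H" and "H < 1"
    and "0 < \<alpha>" and "\<alpha> < 1/2"
    and "0 < 1 - \<alpha>" and "1 - \<alpha> < \<beta>" and "\<beta> < H"
    and "\<gamma> > \<alpha>"
    and "0 < T"
    and "\<And>\<epsilon> t. t \<in> {0..T} \<Longrightarrow> continuously_differentiable (b \<epsilon> t)"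
    and "\<And>j \<epsilon> t. t \<in> {0..T} \<Longrightarrow> continuously_differentiable (\<sigma> j \<epsilon> t)"
  shows "\<exists>C c :: real. \<forall>(M :: real) (\<epsilon> :: real) (g :: real \<Rightarrow> real^'m) (x\<^sub>0 :: real^'n) (x :: real \<Rightarrow> real^'n).
           0 < M \<and> coefficient_bounds T \<gamma> b \<sigma> M \<and>
           holder_on 0 T \<beta> g \<and>
           solves_equation T \<beta> (b \<epsilon>) (\<lambda>j. \<sigma> j \<epsilon>) g x\<^sub>0 x \<longrightarrow>
           (SUP t\<in>{0..T}. norm (x t))
             \<le> C * exp (c * holder_seminorm 0 T \<beta> g powr (1 / \<beta>)) * (norm x\<^sub>0 + 1) \<and>
           holder_seminorm 0 T \<beta> x
             \<le> C * exp (c * holder_seminorm 0 T \<beta> g powr (1 / \<beta>)) * (norm x\<^sub>0 + 1)"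
  \<comment> \<open>The coefficients come before the constants, so \<open>C\<close> and \<open>c\<close> may be built from one fixed
    admissible bound \<open>M\<close>; they then serve for every other admissible bound as well.\<close>
proof (cases "\<exists>M>0. coefficient_bounds T \<gamma> b \<sigma> M")
  case True
  then obtain M where "0 < M" and M: "coefficient_bounds T \<gamma> b \<sigma> M" by blast
  define \<Lambda> where "\<Lambda> = real CARD('n) * M"
  define \<kappa> where "\<kappa> = young_loeve_const (min \<gamma> \<beta> + \<beta>)"
  define A where "A = M * T powr (1 - \<beta>) + real CARD('m) * (M + \<kappa> * (M * T powr \<gamma> + \<Lambda>))"
  define \<mu> where "\<mu> = T * (8 * A) powr (1 / \<beta>)"
  have exps: "1 < \<gamma> + \<beta>" "1 < 2 * \<beta>" "\<beta> \<le> 1" "0 < \<beta>" "0 \<le> \<gamma>" using assms(1-8) by linarith+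
  have "\<Lambda> \<ge> 0" using \<open>0 < M\<close> by (simp add: \<Lambda>_def)
  have "\<kappa> \<ge> 0"
    unfolding \<kappa>_def using exps by (intro young_loeve_const_nonneg) auto
  then have "A > 0"
    unfolding A_def using \<open>0 < M\<close> \<open>0 < T\<close> \<open>\<Lambda> \<ge> 0\<close> by (intro add_pos_nonneg) auto
  have lip: "norm (\<sigma> j \<epsilon> t y - \<sigma> j \<epsilon> t z) \<le> \<Lambda> * norm (y - z)" if "t \<in> {0..T}" for j \<epsilon> t y z
    unfolding \<Lambda>_def using M that assms(11)[OF that]
    by (intro lipschitz_of_partial_deriv_bound) (auto simp: coefficient_bounds_def)
  show ?thesis
  proof (intro exI allI impI, elim conjE)
    fix \<epsilon> :: real and g :: "real \<Rightarrow> real^'m" and x\<^sub>0 :: "real^'n" and x :: "real \<Rightarrow> real^'n"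
    assume g: "holder_on 0 T \<beta> g" and sol: "solves_equation T \<beta> (b \<epsilon>) (\<lambda>j. \<sigma> j \<epsilon>) g x\<^sub>0 x"
    let ?G = "holder_seminorm 0 T \<beta> g"
    have "?G \<ge> 0" using holder_seminorm_nonneg g \<open>0 < T\<close> .
    have x: "holder_on 0 T \<beta> x" using sol unfolding solves_equation_def by blast
    have "controlled_increments T \<beta> (A * (1 + ?G)) x"
      unfolding A_def \<kappa>_def
    proof (rule solution_controlled_increments[OF sol])
      show "norm (g t - g s) \<le> ?G * \<bar>t - s\<bar> powr \<beta>" if "t \<in> {0..T}" "s \<in> {0..T}" for t s
        using holder_on_seminorm[OF g that(2,1)] .
    qed (use M lip \<open>0 < M\<close> \<open>\<Lambda> \<ge> 0\<close> \<open>?G \<ge> 0\<close> exps in \<open>auto simp: coefficient_bounds_def\<close>)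
    from controlled_increments_exponential_bounds[OF this x \<open>A > 0\<close> \<open>?G \<ge> 0\<close> exps(4,3) \<open>0 < T\<close>]
    show "(SUP t\<in>{0..T}. norm (x t)) \<le> (2 + 32 * A) * exp \<mu> * exp ((\<mu> + 1) * ?G powr (1 / \<beta>)) * (norm x\<^sub>0 + 1) \<and>
      holder_seminorm 0 T \<beta> x \<le> (2 + 32 * A) * exp \<mu> * exp ((\<mu> + 1) * ?G powr (1 / \<beta>)) * (norm x\<^sub>0 + 1)"
      using solution_initial_value[OF sol] \<open>0 < T\<close> by (simp add: \<mu>_def)
  qed
qed blast

end
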